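(* Let $C$ be an integral projective curve of arithmetic genus $g\geq 4$ over an algebraically closed field. Assume $\mathrm{gon}(C)<g$ and $\mathrm{Cliff}(C)\geq\mathrm{gon}(C)-3$. Then there is a torsion-free sheaf of rank $1$ on $C$ (with at least two independent global sections) of minimal scrollar dimension but not computing the gonality of $C$ if and only if $\mathrm{Cld}(C)=2$.
   Context: For a torsion-free sheaf $\mathscr{F}$ of rank $1$ on $C$, $\deg(\mathscr{F}):=\chi(\mathscr{F})-\chi(\mathcal{O}_C)$. Gonality: $\mathrm{gon}(C)$ is the smallest $d$ such that there is a torsion-free sheaf $\mathscr{F}$ of rank $1$ on $C$ with $\deg(\mathscr{F})=d$ and $h^0(\mathscr{F})\geq 2$. $\mathscr{F}$ computes the gonality if $h^0(\mathscr{F})\geq 2$ and $\deg(\mathscr{F})=\mathrm{gon}(C)$. Clifford index: $\mathrm{Cliff}(\mathscr{F}):=\deg(\mathscr{F})-2(h^0(\mathscr{F})-1)$. $\mathrm{Cliff}(C)$ is the minimum of $\mathrm{Cliff}(\mathscr{F})$ over all torsion-free rank $1$ sheaves $\mathscr{F}$ with $h^0(\mathscr{F})\geq 2$ and $h^1(\mathscr{F})\geq 2$. Such an $\mathscr{F}$ computes the Clifford index if $\mathrm{Cliff}(\mathscr{F})=\mathrm{Cliff}(C)$. The Clifford dimension is $\mathrm{Cld}(C):=\min\{h^0(\mathscr{F})-1\mid\mathscr{F}\text{ computes }\mathrm{Cliff}(C)\}$. Scrollar dimension: for a torsion-free rank $1$ sheaf $\mathscr{F}$ with $h^0(\mathscr{F})\geq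 2$, the scrollar dimension is $$\mathrm{scd}(\mathscr{F})=\deg(\mathscr{F})-(h^0(\mathscr{F})-1).$$ (It is the dimension of the rational normal scroll in $\mathbb{P}^{g-1}$, containing the canonical model $C'$ of $C$, induced by any pencil $(\mathscr{F},V)$ with $V\subset H^0(\mathscr{F})$, $\dim V=2$; this dimension does not depend on $V$. Here $C'$ is the image of the normalization of $C$ in $\mathbb{P}^{g-1}$ under the morphism given by $H^0(\omega)$, $\omega$ the dualizing sheaf.) The minimal dimension of a scroll containing $C'$ is $\mathrm{gon}(C)-1$, so $\mathscr{F}$ is said to have minimal scrollar dimension if $\mathrm{scd}(\mathscr{F})=\mathrm{gon}(C)-1$. *)

theory Defs
  imports
    "HOL-Analysis.Abstract_Topology"
    "HOL-Library.Extended_Real"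
    "HOL-Algebra.Algebraic_Closure"
    "HOL-Algebra.Generated_Fields"
    "Jordan_Normal_Form.Missing_VectorSpace"
begin

section \<open>Integral projective curves\<close>

text \<open>
  An integral projective scheme over a field \<open>k\<close> is the closure of a point
  \<open>(x\<^sub>0 : ... : x\<^sub>n)\<close> of projective space with coordinates in its function field, here the type
  \<open>'a\<close>.  A point of the scheme is represented by its local ring, a subring of the function
  field (the scheme is separated, so distinct points have distinct local rings); the generic
  point is the function field \<open>UNIV\<close> itself.  A curve is thus a set \<open>C :: 'a set set\<close>.
\<close>

definition univ_ring :: "'a::field ring" where
  "univ_ring = \<lparr>carrier = UNIV, monoid.mult = (*), one = 1, zero = 0, add = (+)\<rparr>"

abbreviation sub_ring :: "'a::field set \<Rightarrow> 'a ring" where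
  "sub_ring A \<equiv> univ_ring\<lparr>carrier := A\<rparr>"

definition chart :: "'a::field set \<Rightarrow> 'a list \<Rightarrow> 'a \<Rightarrow> 'a set" where
  "chart k xs z = generate_ring univ_ring (k \<union> (\<lambda>x. x / z) ` set xs)"

definition localization :: "'a::field set \<Rightarrow> 'a set \<Rightarrow> 'a set" where
  "localization A p = {a / s |a s. a \<in> A \<and> s \<in> A - p}"

text \<open>The scheme \<open>Proj\<close> of the graded algebra generated over \<open>k\<close> by \<open>xs\<close> in degree 1.\<close>

definition proj_points :: "'a::field set \<Rightarrow> 'a list \<Rightarrow> 'a set set" where
  "proj_points k xs =
    {localization (chart k xs z) p |z p.
      z \<in> set xs \<and> z \<noteq> 0 \<and> primeideal p (sub_ring (chart k xs z))}"

text \<open>Some element is transcendental over \<open>k\<close>, and no two elements are algebraically independent.\<close>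

definition trdeg_one :: "'a::field set \<Rightarrow> bool" where
  "trdeg_one k \<longleftrightarrow>
    (\<exists>t. ring.transcendental univ_ring k t) \<and>
    (\<forall>t y. ring.transcendental univ_ring k t \<longrightarrow>
       \<not> ring.transcendental univ_ring (generate_field univ_ring (insert t k)) y)"

text \<open>
  The condition \<open>UNIV \<in> C\<close> says that the coordinate ratios generate the function field, i.e. that
  the local ring at the generic point is the whole type.
\<close>

definition integral_projective_curve :: "'a::field set \<Rightarrow> 'a set set \<Rightarrow> bool" where
  "integral_projective_curve k C \<longleftrightarrow>
    subfield k univ_ring \<and> trdeg_one k \<and> (\<exists>xs. C = proj_points k xs) \<and> UNIV \<in> C"

text \<open>
  The domain of definition \<open>{P \<in> C. f \<in> P}\<close> of a rational function is Zariski open; the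
  principal open set of \<open>h\<close> in an affine chart consists of the points whose local ring contains
  the generators of the chart and \<open>1 / h\<close>, so these domains form a subbasis.
\<close>

definition zariski :: "'a::field set set \<Rightarrow> 'a set topology" where
  "zariski C = topology_generated_by {{P \<in> C. f \<in> P} |f. True}"

abbreviation zopen :: "'a::field set set \<Rightarrow> 'a set set \<Rightarrow> bool" where
  "zopen C U \<equiv> openin (zariski C) U"

text \<open>
  Sections of the structure sheaf, as a module over themselves.  Over the empty set they form
  the zero ring.
\<close>

definition str_ring :: "'a::field set set \<Rightarrow> ('a, 'a) module" where
  "str_ring U =
    \<lparr>carrier = (if U = {} then {0} else \<Inter>U), monoid.mult = (*), one = (if U = {} then 0 else 1),
     zero = 0, add = (+), smult = (*)\<rparr>"


section \<open>Sheaves of modules\<close>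

text \<open>
  In a presheaf \<open>F\<close>, \<open>restr F U V\<close> restricts sections from \<open>U\<close> to \<open>V \<subseteq> U\<close>.
\<close>

record ('a, 'm) presheaf =
  sections :: "'a set set \<Rightarrow> ('a, 'm) module"
  restr :: "'a set set \<Rightarrow> 'a set set \<Rightarrow> 'm \<Rightarrow> 'm"

text \<open>
  Restriction of the structure sheaf to a nonempty set is inclusion of subrings; linearity of
  restriction to the empty set holds trivially, as the sections there form a zero module.
\<close>

locale sheaf_of_modules =
  fixes C :: "'a::field set set" and F :: "('a, 'm) presheaf"
  assumes sections_module: "zopen C U \<Longrightarrow> module (str_ring U) (sections F U)"
    and restr_closed:
      "\<lbrakk>zopen C U; zopen C V; V \<subseteq> U; s \<in> carrier (sections F U)\<rbrakk>
        \<Longrightarrow> restr F U V s \<in> carrier (sections F V)"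
    and restr_add:
      "\<lbrakk>zopen C U; zopen C V; V \<subseteq> U; s \<in> carrier (sections F U); t \<in> carrier (sections F U)\<rbrakk>
        \<Longrightarrow> restr F U V (s \<oplus>\<^bsub>sections F U\<^esub> t) = restr F U V s \<oplus>\<^bsub>sections F V\<^esub> restr F U V t"
    and restr_smult:
      "\<lbrakk>zopen C U; zopen C V; V \<subseteq> U; V \<noteq> {}; a \<in> carrier (str_ring U); s \<in> carrier (sections F U)\<rbrakk>
        \<Longrightarrow> restr F U V (a \<odot>\<^bsub>sections F U\<^esub> s) = a \<odot>\<^bsub>sections F V\<^esub> restr F U V s"
    and restr_id:
      "\<lbrakk>zopen C U; s \<in> carrier (sections F U)\<rbrakk> \<Longrightarrow> restr F U U s = s"
    and restr_restr:
      "\<lbrakk>zopen C U; zopen C V; zopen C W; W \<subseteq> V; V \<subseteq> U; s \<in> carrier (sections F U)\<rbrakk>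
        \<Longrightarrow> restr F V W (restr F U V s) = restr F U W s"
    and glueing:
      "\<lbrakk>\<And>U. U \<in> \<U> \<Longrightarrow> zopen C U; \<And>U. U \<in> \<U> \<Longrightarrow> \<sigma> U \<in> carrier (sections F U);
        \<And>U V. \<lbrakk>U \<in> \<U>; V \<in> \<U>\<rbrakk> \<Longrightarrow> restr F U (U \<inter> V) (\<sigma> U) = restr F V (U \<inter> V) (\<sigma> V)\<rbrakk>
        \<Longrightarrow> \<exists>!t. t \<in> carrier (sections F (\<Union>\<U>)) \<and> (\<forall>U\<in>\<U>. restr F (\<Union>\<U>) U t = \<sigma> U)"

definition structure_sheaf :: "('a::field, 'a) presheaf" where
  "structure_sheaf = \<lparr>sections = str_ring, restr = (\<lambda>U V f. if V = {} then 0 else f)\<rparr>"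

text \<open>Coherence in the sense of Serre (FAC, no. 12).\<close>

definition lin_comb ::
  "('a::field, 'm) presheaf \<Rightarrow> 'a set set \<Rightarrow> 'a set set \<Rightarrow> nat \<Rightarrow> (nat \<Rightarrow> 'a) \<Rightarrow> (nat \<Rightarrow> 'm) \<Rightarrow> 'm" where
  "lin_comb F U V n a s =
    (\<Oplus>\<^bsub>sections F V\<^esub>i\<in>{..<n}. a i \<odot>\<^bsub>sections F V\<^esub> restr F U V (s i))"

definition finite_type :: "'a::field set set \<Rightarrow> ('a, 'm) presheaf \<Rightarrow> bool" where
  "finite_type C F \<longleftrightarrow>
    (\<forall>P\<in>C. \<exists>U n s. zopen C U \<and> P \<in> U \<and> (\<forall>i<n. s i \<in> carrier (sections F U)) \<and>
      (\<forall>V t. zopen C V \<and> V \<subseteq> U \<and> t \<in> carrier (sections F V) \<longrightarrow>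
        (\<forall>Q\<in>V. \<exists>W a. zopen C W \<and> Q \<in> W \<and> W \<subseteq> V \<and> (\<forall>i<n. a i \<in> carrier (str_ring W)) \<and>
          restr F V W t = lin_comb F U W n a s)))"

text \<open>Sections over \<open>V\<close> of the sheaf of relations between \<open>s 0, ..., s (n - 1)\<close>, given over \<open>U\<close>.\<close>

definition relations ::
  "('a::field, 'm) presheaf \<Rightarrow> 'a set set \<Rightarrow> 'a set set \<Rightarrow> nat \<Rightarrow> (nat \<Rightarrow> 'm) \<Rightarrow> (nat \<Rightarrow> 'a) set" where
  "relations F U V n s =
    {a. (\<forall>i<n. a i \<in> carrier (str_ring V)) \<and> lin_comb F U V n a s = \<zero>\<^bsub>sections F V\<^esub>}"

definition relations_finite_type :: "'a::field set set \<Rightarrow> ('a, 'm) presheaf \<Rightarrow> bool" where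
  "relations_finite_type C F \<longleftrightarrow>
    (\<forall>U n s. zopen C U \<and> (\<forall>i<n. s i \<in> carrier (sections F U)) \<longrightarrow>
      (\<forall>P\<in>U. \<exists>V (m::nat) r. zopen C V \<and> P \<in> V \<and> V \<subseteq> U \<and> (\<forall>j<m. r j \<in> relations F U V n s) \<and>
        (\<forall>W a. zopen C W \<and> W \<subseteq> V \<and> a \<in> relations F U W n s \<longrightarrow>
          (\<forall>Q\<in>W. \<exists>W' b. zopen C W' \<and> Q \<in> W' \<and> W' \<subseteq> W \<and>
            (\<forall>j<m. b j \<in> carrier (str_ring W')) \<and>
            (\<forall>i<n. a i = (\<Sum>j<m. b j * r j i))))))"

definition coherent_sheaf :: "'a::field set set \<Rightarrow> ('a, 'm) presheaf \<Rightarrow> bool" where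
  "coherent_sheaf C F \<longleftrightarrow> finite_type C F \<and> relations_finite_type C F"

definition torsion_free :: "'a::field set set \<Rightarrow> ('a, 'm) presheaf \<Rightarrow> bool" where
  "torsion_free C F \<longleftrightarrow>
    (\<forall>U a s. zopen C U \<and> U \<noteq> {} \<and> a \<in> carrier (str_ring U) \<and> s \<in> carrier (sections F U) \<and>
      a \<odot>\<^bsub>sections F U\<^esub> s = \<zero>\<^bsub>sections F U\<^esub> \<longrightarrow> a = 0 \<or> s = \<zero>\<^bsub>sections F U\<^esub>)"

text \<open>
  The stalk at the generic point, the colimit of the sections over all nonempty open sets, has
  dimension 1 over the function field: the germ of some \<open>s\<close> is nonzero and spans it.
\<close>

definition rank_one :: "'a::field set set \<Rightarrow> ('a, 'm) presheaf \<Rightarrow> bool" where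
  "rank_one C F \<longleftrightarrow>
    (\<exists>U s. zopen C U \<and> U \<noteq> {} \<and> s \<in> carrier (sections F U) \<and>
      (\<forall>V. zopen C V \<and> V \<noteq> {} \<and> V \<subseteq> U \<longrightarrow> restr F U V s \<noteq> \<zero>\<^bsub>sections F V\<^esub>) \<and>
      (\<forall>V t. zopen C V \<and> V \<noteq> {} \<and> t \<in> carrier (sections F V) \<longrightarrow>
        (\<exists>W f. zopen C W \<and> W \<noteq> {} \<and> W \<subseteq> U \<inter> V \<and> f \<in> carrier (str_ring W) \<and>
          restr F V W t = f \<odot>\<^bsub>sections F W\<^esub> restr F U W s)))"

text \<open>
  All sections of a torsion-free sheaf of rank 1 over a nonempty open set embed into the generic
  stalk, which is isomorphic to the function field.  Hence every such sheaf is isomorphic to one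
  whose sections are elements of the type \<open>'a\<close> (with arbitrary module operations), so fixing the
  type of sections to \<open>'a\<close> loses no isomorphism class.
\<close>

definition tf_rank_one_sheaf :: "'a::field set set \<Rightarrow> ('a, 'a) presheaf \<Rightarrow> bool" where
  "tf_rank_one_sheaf C F \<longleftrightarrow>
    sheaf_of_modules C F \<and> coherent_sheaf C F \<and> torsion_free C F \<and> rank_one C F"


section \<open>Cohomology\<close>

text \<open>
  \<open>H\<^sup>1\<close> is the colimit of the first Cech cohomology groups over all open covers; on every
  topological space it agrees with derived functor cohomology.  The covers indexed by the points
  themselves, ordered by pointwise inclusion, are cofinal.  An element of \<open>H\<^sup>1\<close> is the class of a
  pair of such a cover and a 1-cocycle on it.
\<close>

type_synonym 'a pcover = "'a set \<Rightarrow> 'a set set"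
type_synonym ('a, 'm) cech1 = "'a pcover \<times> ('a set \<Rightarrow> 'a set \<Rightarrow> 'm)"

definition pcover :: "'a::field set set \<Rightarrow> 'a pcover \<Rightarrow> bool" where
  "pcover C U \<longleftrightarrow> (\<forall>P\<in>C. zopen C (U P) \<and> P \<in> U P)"

definition cocycles :: "'a::field set set \<Rightarrow> ('a, 'm) presheaf \<Rightarrow> ('a, 'm) cech1 set" where
  "cocycles C F =
    {(U, c). pcover C U \<and>
      (\<forall>P\<in>C. \<forall>Q\<in>C. c P Q \<in> carrier (sections F (U P \<inter> U Q))) \<and>
      (\<forall>P\<in>C. \<forall>Q\<in>C. \<forall>R\<in>C. let W = U P \<inter> U Q \<inter> U R in
        restr F (U P \<inter> U Q) W (c P Q) \<oplus>\<^bsub>sections F W\<^esub> restr F (U Q \<inter> U R) W (c Q R)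
          = restr F (U P \<inter> U R) W (c P R))}"

text \<open>Equality in the colimit: over a common refinement, the cocycles differ by a coboundary.\<close>

definition cohomologous ::
  "'a::field set set \<Rightarrow> ('a, 'm) presheaf \<Rightarrow> ('a, 'm) cech1 \<Rightarrow> ('a, 'm) cech1 \<Rightarrow> bool" where
  "cohomologous C F = (\<lambda>(U, c) (V, d).
    \<exists>W b. pcover C W \<and> (\<forall>P\<in>C. W P \<subseteq> U P \<inter> V P \<and> b P \<in> carrier (sections F (W P))) \<and>
      (\<forall>P\<in>C. \<forall>Q\<in>C. let M = sections F (W P \<inter> W Q) in
        restr F (U P \<inter> U Q) (W P \<inter> W Q) (c P Q) \<oplus>\<^bsub>M\<^esub> restr F (W P) (W P \<inter> W Q) (b P)
          = restr F (V P \<inter> V Q) (W P \<inter> W Q) (d P Q) \<oplus>\<^bsub>M\<^esub> restr F (W Q) (W P \<inter> W Q) (b Q)))"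

definition cech_class ::
  "'a::field set set \<Rightarrow> ('a, 'm) presheaf \<Rightarrow> ('a, 'm) cech1 \<Rightarrow> ('a, 'm) cech1 set" where
  "cech_class C F z = {w \<in> cocycles C F. cohomologous C F z w}"

definition cech_add ::
  "('a::field, 'm) presheaf \<Rightarrow> ('a, 'm) cech1 \<Rightarrow> ('a, 'm) cech1 \<Rightarrow> ('a, 'm) cech1" where
  "cech_add F = (\<lambda>(U, c) (V, d).
    (\<lambda>P. U P \<inter> V P,
     \<lambda>P Q. let W = (U P \<inter> V P) \<inter> (U Q \<inter> V Q) in
       restr F (U P \<inter> U Q) W (c P Q) \<oplus>\<^bsub>sections F W\<^esub> restr F (V P \<inter> V Q) W (d P Q)))"

definition cech_smult ::
  "('a::field, 'm) presheaf \<Rightarrow> 'a \<Rightarrow> ('a, 'm) cech1 \<Rightarrow> ('a, 'm) cech1" where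
  "cech_smult F a = (\<lambda>(U, c). (U, \<lambda>P Q. a \<odot>\<^bsub>sections F (U P \<inter> U Q)\<^esub> c P Q))"

text \<open>
  The ring operations of the record are irrelevant to modules and left undefined.
\<close>

definition H1 :: "'a::field set set \<Rightarrow> ('a, 'm) presheaf \<Rightarrow> ('a, ('a, 'm) cech1 set) module" where
  "H1 C F =
    \<lparr>carrier = cech_class C F ` cocycles C F,
     monoid.mult = undefined, one = undefined,
     zero = cech_class C F (\<lambda>P. C, \<lambda>P Q. \<zero>\<^bsub>sections F C\<^esub>),
     add = (\<lambda>A B. \<Union>z\<in>A. \<Union>w\<in>B. cech_class C F (cech_add F z w)),
     smult = (\<lambda>a A. \<Union>z\<in>A. cech_class C F (cech_smult F a z))\<rparr>"

text \<open>\<open>vectorspace.dim\<close> is unspecified in infinite dimension.\<close>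

definition vdim :: "'a::field set \<Rightarrow> ('a, 'v) module \<Rightarrow> nat" where
  "vdim k V =
    (if vectorspace.fin_dim (sub_ring k) V then vectorspace.dim (sub_ring k) V else 0)"

definition h0 :: "'a::field set \<Rightarrow> 'a set set \<Rightarrow> ('a, 'm) presheaf \<Rightarrow> nat" where
  "h0 k C F = vdim k (sections F C)"

definition h1 :: "'a::field set \<Rightarrow> 'a set set \<Rightarrow> ('a, 'm) presheaf \<Rightarrow> nat" where
  "h1 k C F = vdim k (H1 C F)"

text \<open>Cohomology vanishes above the dimension 1 of the curve.\<close>

definition euler_char :: "'a::field set \<Rightarrow> 'a set set \<Rightarrow> ('a, 'm) presheaf \<Rightarrow> int" where
  "euler_char k C F = int (h0 k C F) - int (h1 k C F)"

definition arithmetic_genus :: "'a::field set \<Rightarrow> 'a set set \<Rightarrow> int" where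
  "arithmetic_genus k C = 1 - euler_char k C structure_sheaf"


section \<open>Gonality, Clifford index, Clifford dimension, scrollar dimension\<close>

definition deg :: "'a::field set \<Rightarrow> 'a set set \<Rightarrow> ('a, 'm) presheaf \<Rightarrow> int" where
  "deg k C F = euler_char k C F - euler_char k C structure_sheaf"

text \<open>
  The minima are taken as infima in the extended reals: of a set of integers, the infimum is its
  minimum if there is one, \<open>\<infinity>\<close> if the set is empty, and \<open>-\<infinity>\<close> if it is unbounded below.
\<close>

definition gon :: "'a::field set \<Rightarrow> 'a set set \<Rightarrow> ereal" where
  "gon k C = (INF F \<in> {F. tf_rank_one_sheaf C F \<and> h0 k C F \<ge> 2}. ereal (deg k C F))"

definition computes_gon :: "'a::field set \<Rightarrow> 'a set set \<Rightarrow> ('a, 'a) presheaf \<Rightarrow> bool" where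
  "computes_gon k C F \<longleftrightarrow> h0 k C F \<ge> 2 \<and> ereal (deg k C F) = gon k C"

definition cliff_sheaf :: "'a::field set \<Rightarrow> 'a set set \<Rightarrow> ('a, 'm) presheaf \<Rightarrow> int" where
  "cliff_sheaf k C F = deg k C F - 2 * (int (h0 k C F) - 1)"

definition contributes_cliff :: "'a::field set \<Rightarrow> 'a set set \<Rightarrow> ('a, 'a) presheaf \<Rightarrow> bool" where
  "contributes_cliff k C F \<longleftrightarrow> tf_rank_one_sheaf C F \<and> h0 k C F \<ge> 2 \<and> h1 k C F \<ge> 2"

definition Cliff :: "'a::field set \<Rightarrow> 'a set set \<Rightarrow> ereal" where
  "Cliff k C = (INF F \<in> {F. contributes_cliff k C F}. ereal (cliff_sheaf k C F))"

definition computes_cliff :: "'a::field set \<Rightarrow> 'a set set \<Rightarrow> ('a, 'a) presheaf \<Rightarrow> bool" where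
  "computes_cliff k C F \<longleftrightarrow> contributes_cliff k C F \<and> ereal (cliff_sheaf k C F) = Cliff k C"

definition Cld :: "'a::field set \<Rightarrow> 'a set set \<Rightarrow> ereal" where
  "Cld k C = (INF F \<in> {F. computes_cliff k C F}. ereal (int (h0 k C F) - 1))"

definition scd :: "'a::field set \<Rightarrow> 'a set set \<Rightarrow> ('a, 'm) presheaf \<Rightarrow> int" where
  "scd k C F = deg k C F - (int (h0 k C F) - 1)"

definition minimal_scd :: "'a::field set \<Rightarrow> 'a set set \<Rightarrow> ('a, 'a) presheaf \<Rightarrow> bool" where
  "minimal_scd k C F \<longleftrightarrow> ereal (scd k C F) = gon k C - 1"

end

theory Submission
  imports Defs
begin

text \<open>
  Write \<open>d\<close> for the gonality and \<open>r = h\<^sup>0 - 1\<close>.  Since \<open>h\<^sup>1 = r - deg + g\<close> and \<open>d < g\<close>, both a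
  sheaf of minimal scrollar dimension and a sheaf computing the gonality have \<open>h\<^sup>1 \<ge> 2\<close>, so they
  contribute to the Clifford index.  A sheaf of the first kind has Clifford index \<open>d - 1 - r\<close>, so
  the bound \<open>Cliff \<ge> d - 3\<close> leaves only \<open>r = 1\<close>, when it computes the gonality, and \<open>r = 2\<close>, when it
  computes \<open>Cliff = d - 3\<close>, which no pencil attains.  Conversely, if no pencil computes the
  Clifford index, then a sheaf computing the gonality forces \<open>Cliff = d - 3\<close>.
\<close>

text \<open>Some value lies less than 1/2 above \<open>v\<close>. If it were not \<open>v\<close>, a
  smaller integer value would exist, and that one would fall below the infimum.\<close>

lemma INF_of_int_attained:
  fixes f :: "'b \<Rightarrow> int" and v :: real
  assumes inf: "(INF x\<in>A. ereal (f x)) = ereal v"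
  shows "\<exists>x\<in>A. f x = v"
proof -
  have lower: "v \<le> f x" if "x \<in> A" for x
    using INF_lower[OF that, of "\<lambda>x. ereal (f x)"] inf by simp
  have "(INF x\<in>A. ereal (f x)) < ereal (v + 1/2)" using inf by simp
  then obtain x where x: "x \<in> A" "f x < v + 1/2"
    by (auto simp: INF_less_iff)
  have "f x = v"
  proof (rule ccontr)
    assume "f x \<noteq> v"
    then have "(INF x\<in>A. ereal (f x)) < ereal (f x)" using inf lower[OF x(1)] by simp
    then obtain y where y: "y \<in> A" "f y < f x"
      by (auto simp: INF_less_iff)
    show False using lower[OF y(1)] x(2) y(2) by linarith
  qed
  with x(1) show ?thesis by blast
qed

text \<open>Riemann-Roch, immediate here because \<open>deg\<close> is defined through Euler
  characteristics.\<close>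

lemma h1_eq: "int (h1 k C F) = int (h0 k C F) - 1 - deg k C F + arithmetic_genus k C"
  by (simp add: deg_def euler_char_def arithmetic_genus_def)

lemma gon_le:
  assumes "tf_rank_one_sheaf C F" "h0 k C F \<ge> 2"
  shows "gon k C \<le> ereal (deg k C F)"
  unfolding gon_def using assms by (intro INF_lower) simp

lemma Cliff_le:
  assumes "contributes_cliff k C F"
  shows "Cliff k C \<le> ereal (cliff_sheaf k C F)"
  unfolding Cliff_def using assms by (intro INF_lower) simp

lemma Cld_le:
  assumes "computes_cliff k C F"
  shows "Cld k C \<le> ereal (int (h0 k C F) - 1)"
  unfolding Cld_def using assms by (intro INF_lower) simp

lemma gon_attained:
  fixes x :: real
  assumes "gon k C = ereal x"
  obtains F where "tf_rank_one_sheaf C F" "h0 k C F \<ge> 2" "deg k C F = x"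
  using INF_of_int_attained[of "deg k C"] assms unfolding gon_def by force

lemma Cld_eq_int_attained:
  assumes "Cld k C = ereal n"
  obtains F where "computes_cliff k C F" "int (h0 k C F) - 1 = n"
  using INF_of_int_attained[of "\<lambda>F. int (h0 k C F) - 1"] assms unfolding Cld_def by force

text \<open>By \<open>h1_eq\<close>, \<open>h1\<close> is the genus minus
  \<open>deg - (h0 - 1)\<close>, so the strict bound says exactly \<open>h1 \<ge> 2\<close>.\<close>

lemma contributes_cliff_if_deg_small:
  assumes "tf_rank_one_sheaf C F" "h0 k C F \<ge> 2"
    and "deg k C F - (int (h0 k C F) - 1) < arithmetic_genus k C - 1"
  shows "contributes_cliff k C F"
  using assms h1_eq[of k C F] unfolding contributes_cliff_def by linarith

text \<open>Excludes the value that an infimum takes on degrees unbounded below: sheaves of very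
  negative degree would push the Clifford index below \<open>c\<close>.\<close>

lemma gon_finite_if_Cliff_finite:
  assumes "gon k C < ereal (arithmetic_genus k C)" and cliff: "Cliff k C = ereal c"
  shows "gon k C \<noteq> - \<infinity>"
proof
  assume inf: "gon k C = - \<infinity>"
  \<comment> \<open>Degree below the genus makes the sheaf contribute; degree below \<open>c\<close>
    puts its Clifford index, which is smaller still, below \<open>c\<close>.\<close>
  define m where "m = min (real_of_int (arithmetic_genus k C)) c"
  have "gon k C < ereal m" using inf by simp
  then obtain F where F: "tf_rank_one_sheaf C F" "h0 k C F \<ge> 2" "deg k C F < m"
    unfolding gon_def by (auto simp: INF_less_iff)
  then have "deg k C F < arithmetic_genus k C" "deg k C F < c" unfolding m_def by auto
  with F have "contributes_cliff k C F"
    by (intro contributes_cliff_if_deg_small) auto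
  from Cliff_le[OF this] have "c \<le> cliff_sheaf k C F" using cliff by simp
  then show False using F(2) \<open>deg k C F < c\<close> unfolding cliff_sheaf_def by simp
qed

theorem mainTheorem3:
  fixes k :: "'a::field set" and C :: "'a set set"
  assumes "algebraically_closed (sub_ring k)"
    and "integral_projective_curve k C"
    and "arithmetic_genus k C \<ge> 4"
    and "gon k C < ereal (arithmetic_genus k C)"
    and "Cliff k C \<ge> gon k C - 3"
  shows "(\<exists>F. tf_rank_one_sheaf C F \<and> h0 k C F \<ge> 2 \<and> minimal_scd k C F \<and> \<not> computes_gon k C F)
    \<longleftrightarrow> Cld k C = 2"
proof
  assume "\<exists>F. tf_rank_one_sheaf C F \<and> h0 k C F \<ge> 2 \<and> minimal_scd k C F \<and> \<not> computes_gon k C F"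
  then obtain F where F: "tf_rank_one_sheaf C F" "h0 k C F \<ge> 2"
    and "minimal_scd k C F" "\<not> computes_gon k C F" by blast
  then have "gon k C = ereal (scd k C F + 1)"
    unfolding minimal_scd_def by (cases "gon k C") (auto simp: one_ereal_def)
  then obtain d :: int where d: "gon k C = ereal d" "scd k C F = d - 1"
    using that[of "scd k C F + 1"] by simp
  have "d < arithmetic_genus k C" using assms(4) d by simp
  then have contrib: "contributes_cliff k C F"
    using contributes_cliff_if_deg_small[OF F] d unfolding scd_def by simp
  have bound: "ereal (d - 3) \<le> Cliff k C" using assms(5) d by simp
  have "d - 3 \<le> cliff_sheaf k C F"
    using order_trans[OF bound Cliff_le[OF contrib]] by simp
  \<comment> \<open>A pencil with \<open>scd = d - 1\<close> has degree \<open>d\<close>.\<close>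
  moreover have "int (h0 k C F) - 1 \<noteq> 1"
    using \<open>\<not> computes_gon k C F\<close> F(2) d unfolding computes_gon_def scd_def by auto
  then have "int (h0 k C F) - 1 \<ge> 2" using F(2) by linarith
  ultimately have r: "int (h0 k C F) - 1 = 2"
    using d(2) unfolding cliff_sheaf_def scd_def by presburger
  then have cF: "cliff_sheaf k C F = d - 3"
    using d(2) unfolding cliff_sheaf_def scd_def by presburger
  have cliff: "Cliff k C = ereal (d - 3)"
    using bound Cliff_le[OF contrib] cF by simp
  have "computes_cliff k C F" using contrib cliff cF unfolding computes_cliff_def by simp
  from Cld_le[OF this] have le: "Cld k C \<le> 2" using r by simp
  \<comment> \<open>From \<open>d \<le> deg = d - 3 + 2 * r\<close> follows
    \<open>2 * r \<ge> 3\<close>, hence \<open>r \<ge> 2\<close> by integrality.\<close>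
  have "2 \<le> ereal (int (h0 k C G) - 1)" if G: "computes_cliff k C G" for G
  proof -
    have "cliff_sheaf k C G = d - 3" and G': "tf_rank_one_sheaf C G" "h0 k C G \<ge> 2"
      using G cliff unfolding computes_cliff_def contributes_cliff_def by auto
    moreover have "d \<le> deg k C G" using gon_le[OF G'] d by simp
    ultimately have "int (h0 k C G) - 1 \<ge> 2" unfolding cliff_sheaf_def by presburger
    then show ?thesis by simp
  qed
  then have "2 \<le> Cld k C" unfolding Cld_def by (intro INF_greatest) simp
  with le show "Cld k C = 2" by simp
next
  assume "Cld k C = 2"
  then obtain F where F: "computes_cliff k C F" and r: "int (h0 k C F) - 1 = 2"
    using Cld_eq_int_attained[of k C 2] by auto
  then have F': "tf_rank_one_sheaf C F" "h0 k C F \<ge> 2"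
    and cliff: "Cliff k C = ereal (cliff_sheaf k C F)"
    unfolding computes_cliff_def contributes_cliff_def by auto
  obtain x where x: "gon k C = ereal x"
    using gon_finite_if_Cliff_finite[OF assms(4) cliff] assms(4) by (cases "gon k C") auto
  obtain G d where G: "tf_rank_one_sheaf C G" "h0 k C G \<ge> 2" "deg k C G = d" and "d = x"
    using gon_attained[OF x] by blast
  then have d: "gon k C = ereal d" using x by simp
  have contrib: "contributes_cliff k C G"
    using assms(4) d G by (intro contributes_cliff_if_deg_small) auto
  have lower: "d - 3 \<le> cliff_sheaf k C F" using assms(5) d cliff by simp
  have upper: "cliff_sheaf k C F \<le> cliff_sheaf k C G" using Cliff_le[OF contrib] cliff by simp
  \<comment> \<open>Equality would give \<open>G\<close> at least three sections, as
    \<open>Cld = 2\<close>, hence Clifford index at most \<open>d - 4\<close>.\<close>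
  have "cliff_sheaf k C F \<noteq> cliff_sheaf k C G"
  proof
    assume eq: "cliff_sheaf k C F = cliff_sheaf k C G"
    then have "computes_cliff k C G" using contrib cliff unfolding computes_cliff_def by simp
    from Cld_le[OF this] have "int (h0 k C G) - 1 \<ge> 2" using \<open>Cld k C = 2\<close> by simp
    then show False using eq lower G(3) unfolding cliff_sheaf_def by presburger
  qed
  \<comment> \<open>It is at least \<open>d - 3\<close> and strictly below that of \<open>G\<close>,
    which is at most \<open>d - 2\<close>.\<close>
  then have "cliff_sheaf k C F = d - 3"
    using lower upper G unfolding cliff_sheaf_def by presburger
  then have deg: "deg k C F = d + 1" using r unfolding cliff_sheaf_def by presburger
  then have "minimal_scd k C F"
    using d r unfolding minimal_scd_def scd_def by (simp add: one_ereal_def)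
  moreover have "\<not> computes_gon k C F"
    using d deg unfolding computes_gon_def by simp
  ultimately show "\<exists>F. tf_rank_one_sheaf C F \<and> h0 k C F \<ge> 2 \<and> minimal_scd k C F \<and> \<not> computes_gon k C F"
    using F' by blast
qed

end
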